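(* Let $a<b$ be real numbers, $1<p<\infty$ and $r\in(0,1]$. Let $f,u:[a,b]\to\mathbb{R}$ be such that $u\in L^p[a,b]$, $f$ is Lipschitz on $[a,b]$ with constant $L>0$, and $u$ is $r$-$H$-Hölder continuous on $[a,b]$ with constant $H>0$. Then $$\left|\mathcal{R}^{[a,b]}(f,u;t_0,x,t_1)\right|\le LH\left[\frac{(t_0-a)^{r+1}}{(rp+1)^{\frac1p}}+(t_1-t_0)^{1-\frac1p}\,A^{\frac1p}+\frac{(b-t_1)^{r+1}}{(rp+1)^{\frac1p}}\right],$$ where $$A=\begin{cases}\dfrac{(t_1-x)^{rp+1}-(t_0-x)^{rp+1}}{rp+1}, & a\le x\le t_0\le t_1\le b,\\[2mm]\dfrac{(x-t_0)^{rp+1}+(t_1-x)^{rp+1}}{rp+1}, & a\le t_0\le x\le t_1\le b,\\[2mm]\dfrac{(x-t_0)^{rp+1}-(x-t_1)^{rp+1}}{rp+1}, & a\le t_0\le t_1\le x\le b.\end{cases}$$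
   Context: A function $u:[a,b]\to\mathbb{R}$ is $r$-$H$-Hölder continuous if $|u(s)-u(t)|\le H|s-t|^r$ for all $s,t\in[a,b]$. For $t_0,x,t_1\in[a,b]$ the remainder is $$\mathcal{R}^{[a,b]}(f,u;t_0,x,t_1):=\int_a^b f(s)\,du(s)-[u(x)-u(a)]f(t_0)-[u(b)-u(x)]f(t_1),$$ where $\int_a^b f\,du$ is the Riemann–Stieltjes integral. *)

theory Defs
  imports "HOL-Analysis.Analysis"
begin

definition tagged_partition :: "real \<Rightarrow> real \<Rightarrow> nat \<Rightarrow> (nat \<Rightarrow> real) \<Rightarrow> (nat \<Rightarrow> real) \<Rightarrow> bool" where
  "tagged_partition a b n x \<xi> \<longleftrightarrow>
     x 0 = a \<and> x n = b \<and> (\<forall>i<n. x i < x (Suc i) \<and> \<xi> i \<in> {x i..x (Suc i)})"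

text \<open>
  The Riemann--Stieltjes integral is the limit of the Riemann--Stieltjes sums as the mesh of the
  tagged partition tends to zero.
\<close>

definition has_RS_integral ::
  "(real \<Rightarrow> real) \<Rightarrow> (real \<Rightarrow> real) \<Rightarrow> real \<Rightarrow> real \<Rightarrow> real \<Rightarrow> bool" where
  "has_RS_integral f u a b I \<longleftrightarrow>
     (\<forall>\<epsilon>>0. \<exists>\<delta>>0. \<forall>n x \<xi>.
        tagged_partition a b n x \<xi> \<and> (\<forall>i<n. x (Suc i) - x i < \<delta>) \<longrightarrow>
        \<bar>(\<Sum>i<n. f (\<xi> i) * (u (x (Suc i)) - u (x i))) - I\<bar> < \<epsilon>)"

definition RS_integral :: "real \<Rightarrow> real \<Rightarrow> (real \<Rightarrow> real) \<Rightarrow> (real \<Rightarrow> real) \<Rightarrow> real" where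
  "RS_integral a b f u = (THE I. has_RS_integral f u a b I)"

definition remainder ::
  "real \<Rightarrow> real \<Rightarrow> (real \<Rightarrow> real) \<Rightarrow> (real \<Rightarrow> real) \<Rightarrow> real \<Rightarrow> real \<Rightarrow> real \<Rightarrow> real" where
  "remainder a b f u t0 x t1 =
     RS_integral a b f u - (u x - u a) * f t0 - (u b - u x) * f t1"

definition Hoelder_on :: "real \<Rightarrow> real \<Rightarrow> real set \<Rightarrow> (real \<Rightarrow> real) \<Rightarrow> bool" where
  "Hoelder_on r H S u \<longleftrightarrow> (\<forall>s\<in>S. \<forall>t\<in>S. \<bar>u s - u t\<bar> \<le> H * \<bar>s - t\<bar> powr r)"

definition in_Lp_on :: "real \<Rightarrow> real set \<Rightarrow> (real \<Rightarrow> real) \<Rightarrow> bool" where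
  "in_Lp_on p S u \<longleftrightarrow>
     u \<in> borel_measurable (lebesgue_on S) \<and>
     integrable (lebesgue_on S) (\<lambda>t. \<bar>u t\<bar> powr p)"

definition A_const :: "real \<Rightarrow> real \<Rightarrow> real \<Rightarrow> real \<Rightarrow> real \<Rightarrow> real" where
  "A_const r p t0 x t1 =
     (if x \<le> t0 then ((t1 - x) powr (r * p + 1) - (t0 - x) powr (r * p + 1)) / (r * p + 1)
      else if x \<le> t1 then ((x - t0) powr (r * p + 1) + (t1 - x) powr (r * p + 1)) / (r * p + 1)
      else ((x - t0) powr (r * p + 1) - (x - t1) powr (r * p + 1)) / (r * p + 1))"

text \<open>
  The three formulas agree where their ranges overlap, so each holds on its closed range.
\<close>

lemma A_const_cases:
  "\<lbrakk>x \<le> t0; t0 \<le> t1\<rbrakk> \<Longrightarrow>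
     A_const r p t0 x t1 = ((t1 - x) powr (r * p + 1) - (t0 - x) powr (r * p + 1)) / (r * p + 1)"
  "\<lbrakk>t0 \<le> x; x \<le> t1\<rbrakk> \<Longrightarrow>
     A_const r p t0 x t1 = ((x - t0) powr (r * p + 1) + (t1 - x) powr (r * p + 1)) / (r * p + 1)"
  "\<lbrakk>t0 \<le> t1; t1 \<le> x\<rbrakk> \<Longrightarrow>
     A_const r p t0 x t1 = ((x - t0) powr (r * p + 1) - (x - t1) powr (r * p + 1)) / (r * p + 1)"
  by (auto simp: A_const_def)

end

theory Submission
  imports Defs
begin

text \<open>
  Since \<open>f\<close> is Lipschitz and \<open>u\<close> is continuous, \<open>\<integral> u df\<close> exists: \<open>g(s) = f(s) + 2 L s\<close> is
  bi-Lipschitz and increasing, so \<open>\<integral> u dg\<close> is the ordinary integral of \<open>u \<circ> g\<^sup>-\<^sup>1\<close>. Integration by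
  parts then gives \<open>\<integral> f du\<close> and turns the remainder into
  \<open>\<integral> (u(a) - u) df\<close> over \<open>[a, t\<^sub>0]\<close> plus \<open>\<integral> (u(x) - u) df\<close> over \<open>[t\<^sub>0, t\<^sub>1]\<close> plus
  \<open>\<integral> (u(b) - u) df\<close> over \<open>[t\<^sub>1, b]\<close>. Each piece is at most
  \<open>L H \<integral> |s - y|\<^sup>r ds\<close> with \<open>y\<close> one of \<open>a, x, b\<close>, and the Hoelder inequality with exponent \<open>p\<close>
  bounds this by the corresponding term on the right-hand side.
\<close>

section \<open>Power integrals\<close>

text \<open>Hoelder's inequality against the constant function 1, obtained by integrating a
  pointwise Young inequality. Comparing \<open>v s\<close> with the \<open>p\<close>-mean
  \<open>m\<close> of \<open>v\<close> makes the Young bound an equality where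
  \<open>v s = m\<close>, so no constant is lost.\<close>

lemma integral_le_powr_mean:
  fixes v :: "real \<Rightarrow> real"
  assumes cont: "continuous_on {c..d} v" and nonneg: "\<And>s. s \<in> {c..d} \<Longrightarrow> 0 \<le> v s"
    and p: "1 < p" and "c \<le> d"
  shows "integral {c..d} v \<le>
    (d - c) powr (1 - 1 / p) * integral {c..d} (\<lambda>s. v s powr p) powr (1 / p)"
proof (cases "c < d")
  case False
  then show ?thesis using \<open>c \<le> d\<close> by simp
next
  case True
  define I where "I = integral {c..d} (\<lambda>s. v s powr p)"
  have contp: "continuous_on {c..d} (\<lambda>s. v s powr p)"
    using p nonneg by (intro continuous_on_powr' cont continuous_on_const) auto
  have "0 \<le> I"
    unfolding I_def by (intro integral_nonneg integrable_continuous_real contp) auto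
  \<comment> \<open>The scale \<open>m\<close> chosen below must be positive, so
    \<open>I = 0\<close> is treated apart; there continuity forces \<open>v\<close> to
    vanish.\<close>
  show ?thesis
  proof (cases "I = 0")
    case True
    then have "\<forall>s\<in>{c..d}. v s powr p = 0"
      unfolding I_def using integral_eq_0_iff[OF contp \<open>c < d\<close>] by auto
    then have "integral {c..d} v = integral {c..d} (\<lambda>_. 0)"
      by (intro integral_cong) auto
    then show ?thesis by simp
  next
    case False
    with \<open>0 \<le> I\<close> have "0 < I" by simp
    \<comment> \<open>This value minimises the integrated Young bound
      \<open>I * (m powr (1 - p) / p) + (1 - 1 / p) * m * (d - c)\<close> over positive
      \<open>m\<close>.\<close>
    define m where "m = (I / (d - c)) powr (1 / p)"
    have "0 < m" using \<open>0 < I\<close> \<open>c < d\<close> by (simp add: m_def)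
    have young: "v s \<le> v s powr p * (m powr (1 - p) / p) + (1 - 1 / p) * m"
      if "s \<in> {c..d}" for s
    proof (cases "v s = 0")
      case True
      then show ?thesis using p \<open>0 < m\<close> by simp
    next
      case False
      with nonneg[OF that] have "0 < v s" by simp
      \<comment> \<open>Weighted arithmetic-geometric mean of
        \<open>v s powr p * m powr (1 - p)\<close> and \<open>m\<close>: in the geometric mean the
        powers of \<open>m\<close> cancel and only \<open>v s\<close> is left.\<close>
      have 1: "(v s powr p * m powr (1 - p)) powr (1 / p) * m powr (1 - 1 / p)
          \<le> 1 / p * (v s powr p * m powr (1 - p)) + (1 - 1 / p) * m"
        using p \<open>0 < v s\<close> \<open>0 < m\<close> by (intro Youngs_inequality_0) auto
      have 2: "(v s powr p * m powr (1 - p)) powr (1 / p) * m powr (1 - 1 / p)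
          = v s * (m powr ((1 - p) / p) * m powr (1 - 1 / p))"
        using p \<open>0 < v s\<close> \<open>0 < m\<close> by (simp add: powr_mult powr_powr)
      have 3: "m powr ((1 - p) / p) * m powr (1 - 1 / p) = 1"
        using p \<open>0 < m\<close> by (simp add: powr_add[symmetric] diff_divide_distrib)
      show ?thesis using 1 unfolding 2 3 by simp
    qed
    have "integral {c..d} v
        \<le> integral {c..d} (\<lambda>s. v s powr p * (m powr (1 - p) / p) + (1 - 1 / p) * m)"
      using young by (intro integral_le integrable_continuous_real cont continuous_intros contp)
    also have "\<dots> = I * (m powr (1 - p) / p) + (1 - 1 / p) * m * (d - c)"
      unfolding I_def using \<open>c < d\<close> p
      by (subst integral_add)
        (auto intro!: integrable_continuous_real contp continuous_intros)
    also have "I * (m powr (1 - p) / p) = m * (d - c) / p"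
    proof -
      have "m powr p = I / (d - c)"
        using p \<open>0 < I\<close> \<open>c < d\<close> by (simp add: m_def powr_powr)
      then have "I = m powr p * (d - c)" using \<open>c < d\<close> by simp
      then have "I * m powr (1 - p) = (m powr p * m powr (1 - p)) * (d - c)" by simp
      also have "m powr p * m powr (1 - p) = m"
        using \<open>0 < m\<close> by (simp add: powr_add[symmetric])
      finally show ?thesis by simp
    qed
    also have "m * (d - c) / p + (1 - 1 / p) * m * (d - c) = m * (d - c)"
      by (simp add: algebra_simps)
    also have "\<dots> = (d - c) powr (1 - 1 / p) * I powr (1 / p)"
      using \<open>0 < I\<close> \<open>c < d\<close> by (simp add: m_def powr_divide powr_diff)
    finally show ?thesis by (simp add: I_def)
  qed
qed

section \<open>Powers of the distance to a point\<close>

lemma continuous_on_abs_diff_powr: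
  fixes x q :: real
  assumes "0 < q"
  shows "continuous_on S (\<lambda>s. \<bar>s - x\<bar> powr q)"
  using assms by (intro continuous_on_powr' continuous_intros) auto

text \<open>The antiderivative \<open>(s - x) * \<bar>s - x\<bar> powr q / (q + 1)\<close> has one
  formula on both sides of \<open>x\<close>. The derivative is checked on each side, and
  \<open>x\<close> itself is an exceptional point of the fundamental theorem, where continuity
  suffices.\<close>

lemma has_integral_abs_diff_powr:
  fixes x q :: real
  assumes "0 < q" "c \<le> d"
  shows "((\<lambda>s. \<bar>s - x\<bar> powr q) has_integral
    (((d - x) * \<bar>d - x\<bar> powr q - (c - x) * \<bar>c - x\<bar> powr q) / (q + 1))) {c..d}"
proof -
  define G where "G s = (s - x) * \<bar>s - x\<bar> powr q / (q + 1)" for s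
  have "((\<lambda>s. \<bar>s - x\<bar> powr q) has_integral (G d - G c)) {c..d}"
  proof (rule fundamental_theorem_of_calculus_interior_strong[where S = "{x}"])
    show "continuous_on {c..d} G"
      unfolding G_def using assms
      by (intro continuous_intros continuous_on_abs_diff_powr) auto
    fix s assume s: "s \<in> {c<..<d} - {x}"
    have "(G has_real_derivative \<bar>s - x\<bar> powr q) (at s)"
    proof (cases "x < s")
      case True
      have "((\<lambda>s. (s - x) powr (q + 1)) has_real_derivative (q + 1) * \<bar>s - x\<bar> powr q) (at s)"
        using True assms by (auto intro!: derivative_eq_intros)
      from DERIV_cdivide[OF this, of "q + 1"]
      have "((\<lambda>s. (s - x) powr (q + 1) / (q + 1)) has_real_derivative \<bar>s - x\<bar> powr q) (at s)"
        using assms by simp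
      then show ?thesis
      proof (rule has_field_derivative_transform_within_open[where S = "{x<..}"])
        show "(y - x) powr (q + 1) / (q + 1) = G y" if "y \<in> {x<..}" for y
          using that by (simp add: G_def powr_add)
      qed (use True in auto)
    next
      case False
      with s have "s < x" by auto
      have "((\<lambda>s. - ((x - s) powr (q + 1))) has_real_derivative (q + 1) * \<bar>s - x\<bar> powr q) (at s)"
        using \<open>s < x\<close> assms by (auto intro!: derivative_eq_intros)
      from DERIV_cdivide[OF this, of "q + 1"]
      have "((\<lambda>s. - ((x - s) powr (q + 1) / (q + 1))) has_real_derivative \<bar>s - x\<bar> powr q) (at s)"
        using assms by simp
      then show ?thesis
      proof (rule has_field_derivative_transform_within_open[where S = "{..<x}"])
        show "- ((x - y) powr (q + 1) / (q + 1)) = G y" if "y \<in> {..<x}" for y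
          using that assms by (simp add: G_def powr_add field_simps)
      qed (use \<open>s < x\<close> in auto)
    qed
    then show "(G has_vector_derivative \<bar>s - x\<bar> powr q) (at s)"
      by (simp add: has_real_derivative_iff_has_vector_derivative)
  qed (use assms in auto)
  then show ?thesis by (simp add: G_def diff_divide_distrib)
qed

text \<open>This identifies \<open>A_const\<close>: its three branches are the signs that
  \<open>c - x\<close> and \<open>d - x\<close> can take in the antiderivative.\<close>

lemma integral_abs_diff_powr_eq_A_const:
  assumes "0 < r * p" "c \<le> d"
  shows "integral {c..d} (\<lambda>s. \<bar>s - x\<bar> powr (r * p)) = A_const r p c x d"
proof -
  have pos: "(z - x) * \<bar>z - x\<bar> powr (r * p) = (z - x) powr (r * p + 1)" if "x \<le> z" for z
    using that by (simp add: powr_add)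
  have neg: "(z - x) * \<bar>z - x\<bar> powr (r * p) = - ((x - z) powr (r * p + 1))" if "z \<le> x" for z
    using that by (simp add: powr_add algebra_simps)
  consider "x \<le> c" "x \<le> d" | "\<not> x \<le> c" "x \<le> d" | "\<not> x \<le> c" "\<not> x \<le> d"
    using \<open>c \<le> d\<close> by linarith
  then show ?thesis
    unfolding integral_unique[OF has_integral_abs_diff_powr[OF assms]] A_const_def
    by cases (use pos[of c] pos[of d] neg[of c] neg[of d] in simp_all)
qed

lemma integral_abs_diff_powr_le:
  fixes x r p :: real
  assumes "0 < r" "1 < p" "c \<le> d"
  shows "integral {c..d} (\<lambda>s. \<bar>s - x\<bar> powr r) \<le>
    (d - c) powr (1 - 1 / p) * A_const r p c x d powr (1 / p)"
  using integral_le_powr_mean[OF continuous_on_abs_diff_powr[OF \<open>0 < r\<close>] _ \<open>1 < p\<close> \<open>c \<le> d\<close>, of x]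
    integral_abs_diff_powr_eq_A_const[of r p c d x] assms
  by (simp add: powr_powr)

text \<open>Serves the two outer intervals, where the reference point is an end point and
  \<open>A_const\<close> is a single power. The exponents add up as
  \<open>(1 - 1 / p) + (r + 1 / p) = r + 1\<close>.\<close>

lemma powr_mean_collapse:
  fixes r p w :: real
  assumes "0 < r" "1 < p" "0 \<le> w"
  shows "w powr (1 - 1 / p) * (w powr (r * p + 1) / (r * p + 1)) powr (1 / p) =
    w powr (r + 1) / (r * p + 1) powr (1 / p)"
proof -
  have "0 < r * p" using assms by simp
  have "(r * p + 1) * (1 / p) = r + 1 / p"
    using assms by (simp add: field_simps)
  then have "w powr (1 - 1 / p) * (w powr (r * p + 1)) powr (1 / p) = w powr (r + 1)"
    unfolding powr_powr by (simp add: powr_add[symmetric] add.commute)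
  then show ?thesis
    using \<open>0 < r * p\<close> assms by (simp add: powr_divide)
qed

section \<open>Integration against a Lipschitz function\<close>

text \<open>
  \<open>J\<close> plays the role of \<open>t \<mapsto> \<integral>\<^sub>a\<^sup>t u df\<close>, characterised by the error of one Riemann--Stieltjes term.
\<close>

definition stieltjes_primitive ::
  "real \<Rightarrow> real \<Rightarrow> real \<Rightarrow> (real \<Rightarrow> real) \<Rightarrow> (real \<Rightarrow> real) \<Rightarrow> (real \<Rightarrow> real) \<Rightarrow> bool" where
  "stieltjes_primitive C a b u f J \<longleftrightarrow>
     (\<forall>c d y \<omega>. a \<le> c \<longrightarrow> c \<le> d \<longrightarrow> d \<le> b \<longrightarrow> y \<in> {c..d} \<longrightarrow>
        (\<forall>s\<in>{c..d}. \<bar>u s - u y\<bar> \<le> \<omega>) \<longrightarrow> \<bar>J d - J c - u y * (f d - f c)\<bar> \<le> C * \<omega> * (d - c))"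

lemma stieltjes_primitiveD:
  assumes "stieltjes_primitive C a b u f J" "a \<le> c" "c \<le> d" "d \<le> b" "y \<in> {c..d}"
    "\<And>s. s \<in> {c..d} \<Longrightarrow> \<bar>u s - u y\<bar> \<le> \<omega>"
  shows "\<bar>J d - J c - u y * (f d - f c)\<bar> \<le> C * \<omega> * (d - c)"
  using assms unfolding stieltjes_primitive_def by blast

lemma integral_const_approx:
  fixes w :: "real \<Rightarrow> real"
  assumes "w integrable_on {c..d}" "c \<le> d" "\<And>s. s \<in> {c..d} \<Longrightarrow> \<bar>w s - k\<bar> \<le> \<omega>"
  shows "\<bar>integral {c..d} w - k * (d - c)\<bar> \<le> \<omega> * (d - c)"
proof -
  have "integral {c..d} (\<lambda>s. w s - k) = integral {c..d} w - k * (d - c)"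
    using assms by (subst integral_diff) auto
  moreover have "norm (integral {c..d} (\<lambda>s. w s - k)) \<le> integral {c..d} (\<lambda>_. \<omega>)"
    using assms by (intro integral_norm_bound_integral integrable_diff) auto
  ultimately show ?thesis
    using assms by (simp add: mult.commute)
qed

text \<open>Since \<open>f\<close> need not be monotone, \<open>2 * L * s\<close> is added: the
  slopes of \<open>g\<close> then lie between \<open>L\<close> and \<open>3 * L\<close>, so
  \<open>g\<close> has a continuous inverse \<open>h\<close>. The factor 5 is 3 from the upper slope
  of \<open>g\<close> plus 2 from the linear term taken away again.\<close>

lemma stieltjes_primitive_exists:
  assumes f: "L-lipschitz_on {a..b} f" and u: "continuous_on {a..b} u" and "0 < L"
  shows "\<exists>J. stieltjes_primitive (5 * L) a b u f J"
proof -
  define g where "g s = f s + 2 * L * s" for s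
  define h where "h = inv_into {a..b} g"
  have lip: "\<bar>f d - f c\<bar> \<le> L * (d - c)" if "a \<le> c" "c \<le> d" "d \<le> b" for c d
    using lipschitz_onD[OF f, of d c] that by (auto simp: dist_real_def)
  have g_ge: "L * (d - c) \<le> g d - g c" and g_le: "g d - g c \<le> 3 * L * (d - c)"
    if "a \<le> c" "c \<le> d" "d \<le> b" for c d
    using lip[OF that] unfolding g_def by (auto simp: abs_le_iff algebra_simps)
  have mono: "g c \<le> g d" if "a \<le> c" "c \<le> d" "d \<le> b" for c d
    using g_ge[OF that] that \<open>0 < L\<close> by (smt (verit) mult_nonneg_nonneg)
  have strict: "g c < g d" if "a \<le> c" "c < d" "d \<le> b" for c d
    using g_ge[of c d] that \<open>0 < L\<close> by (smt (verit) mult_pos_pos)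
  have inj: "inj_on g {a..b}"
    using strict by (intro linorder_inj_onI) (auto, fastforce+)
  have hg: "h (g s) = s" if "s \<in> {a..b}" for s
    unfolding h_def using inj that by (rule inv_into_f_f)
  have contg: "continuous_on {a..b} g"
    unfolding g_def by (intro continuous_intros lipschitz_on_continuous_on[OF f])
  have image: "\<exists>s\<in>{c..d}. g s = y" if "a \<le> c" "c \<le> d" "d \<le> b" "y \<in> {g c..g d}" for c d y
    using IVT'[of g c y d] that continuous_on_subset[OF contg, of "{c..d}"] by auto
  have conth: "continuous_on (g ` {a..b}) h"
    using hg by (intro continuous_on_inv contg) auto
  have contw: "continuous_on {g c..g d} (u \<circ> h)" if "a \<le> c" "c \<le> d" "d \<le> b" for c d
  proof -
    have "continuous_on (g ` {a..b}) (u \<circ> h)"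
      using hg by (intro continuous_on_compose conth continuous_on_subset[OF u]) auto
    moreover have "{g c..g d} \<subseteq> g ` {a..b}"
      using image[OF that] that by fastforce
    ultimately show ?thesis by (rule continuous_on_subset)
  qed
  \<comment> \<open>The first integral is that of \<open>u\<close> against \<open>g\<close> after
    the substitution \<open>z = g s\<close>; the second removes the share of
    \<open>2 * L * s\<close>.\<close>
  define J where "J t = integral {g a..g t} (u \<circ> h) - 2 * L * integral {a..t} u" for t
  have J_diff: "J d - J c = integral {g c..g d} (u \<circ> h) - 2 * L * integral {c..d} u"
    if "a \<le> c" "c \<le> d" "d \<le> b" for c d
  proof -
    have "integral {g a..g c} (u \<circ> h) + integral {g c..g d} (u \<circ> h) = integral {g a..g d} (u \<circ> h)"
      using that
      by (intro Henstock_Kurzweil_Integration.integral_combine mono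
          integrable_continuous_real contw) auto
    moreover have "integral {a..c} u + integral {c..d} u = integral {a..d} u"
      using that
      by (intro Henstock_Kurzweil_Integration.integral_combine
          integrable_continuous_real continuous_on_subset[OF u]) auto
    ultimately show ?thesis
      unfolding J_def by (simp add: algebra_simps flip: distrib_left)
  qed
  have "\<bar>J d - J c - u y * (f d - f c)\<bar> \<le> 5 * L * \<omega> * (d - c)"
    if cd: "a \<le> c" "c \<le> d" "d \<le> b" and y: "y \<in> {c..d}"
      and osc: "\<forall>s\<in>{c..d}. \<bar>u s - u y\<bar> \<le> \<omega>" for c d y \<omega>
  proof -
    have "0 \<le> \<omega>" using osc y by fastforce
    have "\<bar>integral {g c..g d} (u \<circ> h) - u y * (g d - g c)\<bar> \<le> \<omega> * (g d - g c)"
    proof (rule integral_const_approx)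
      fix z assume "z \<in> {g c..g d}"
      then obtain s where "s \<in> {c..d}" "z = g s" using image[OF cd] by blast
      then show "\<bar>(u \<circ> h) z - u y\<bar> \<le> \<omega>" using osc hg cd by auto
    qed (use cd in \<open>auto intro: mono integrable_continuous_real contw\<close>)
    also have "\<dots> \<le> \<omega> * (3 * L * (d - c))"
      using g_le[OF cd] \<open>0 \<le> \<omega>\<close> by (rule mult_left_mono)
    finally have 1: "\<bar>integral {g c..g d} (u \<circ> h) - u y * (g d - g c)\<bar> \<le> \<omega> * (3 * L * (d - c))" .
    have "\<bar>integral {c..d} u - u y * (d - c)\<bar> \<le> \<omega> * (d - c)"
      using cd osc
      by (intro integral_const_approx integrable_continuous_real continuous_on_subset[OF u]) auto
    then have "2 * L * \<bar>integral {c..d} u - u y * (d - c)\<bar> \<le> 2 * L * (\<omega> * (d - c))"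
      using \<open>0 < L\<close> by (intro mult_left_mono) auto
    then have 2: "\<bar>2 * L * (integral {c..d} u - u y * (d - c))\<bar> \<le> 2 * L * (\<omega> * (d - c))"
      using \<open>0 < L\<close> by (simp add: abs_mult)
    have "J d - J c - u y * (f d - f c) =
        (integral {g c..g d} (u \<circ> h) - u y * (g d - g c))
          - 2 * L * (integral {c..d} u - u y * (d - c))"
      unfolding J_diff[OF cd] g_def by (simp add: algebra_simps)
    also have "\<bar>\<dots>\<bar> \<le> \<omega> * (3 * L * (d - c)) + 2 * L * (\<omega> * (d - c))"
      using 1 2 by linarith
    finally show ?thesis by (simp add: algebra_simps)
  qed
  then show ?thesis unfolding stieltjes_primitive_def by blast
qed

section \<open>From local to global estimates\<close>

lemma continuous_on_interval_oscillation:
  fixes u :: "real \<Rightarrow> real"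
  assumes "continuous_on {a..b} u" "0 < \<omega>"
  obtains \<delta> where "0 < \<delta>"
    "\<And>s t. s \<in> {a..b} \<Longrightarrow> t \<in> {a..b} \<Longrightarrow> \<bar>s - t\<bar> < \<delta> \<Longrightarrow> \<bar>u s - u t\<bar> \<le> \<omega>"
proof -
  have "uniformly_continuous_on {a..b} u"
    using assms by (intro compact_uniformly_continuous) auto
  then obtain \<delta> where "0 < \<delta>"
    "\<forall>t\<in>{a..b}. \<forall>s\<in>{a..b}. dist s t < \<delta> \<longrightarrow> dist (u s) (u t) < \<omega>"
    using \<open>0 < \<omega>\<close> unfolding uniformly_continuous_on_def by meson
  then show ?thesis
    by (intro that[of \<delta>]) (auto simp: dist_real_def less_imp_le)
qed

lemma ex_uniform_step_less:
  fixes w \<delta> :: real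
  assumes "0 < \<delta>"
  obtains n :: nat where "0 < n" "w / real n < \<delta>"
proof -
  \<comment> \<open>The maximum with 1 keeps \<open>n\<close> positive whatever the sign of
    \<open>w\<close>.\<close>
  obtain n :: nat where n: "max 1 (w / \<delta>) < real n"
    using reals_Archimedean2 by blast
  then have "0 < n" by simp
  moreover from n this have "w / real n < \<delta>"
    using assms by (simp add: field_simps)
  ultimately show ?thesis by (rule that)
qed

text \<open>Equal steps shorter than \<open>\<delta>\<close> lead from \<open>c\<close> to
  \<open>d\<close>, and the local inequalities chain along them. This replaces summing local error
  bounds over a partition.\<close>

lemma le_if_uniformly_locally_mono:
  fixes q :: "real \<Rightarrow> real"
  assumes "0 < \<delta>" "c \<le> d"
    and loc: "\<And>s t. c \<le> s \<Longrightarrow> s \<le> t \<Longrightarrow> t \<le> d \<Longrightarrow> t - s < \<delta> \<Longrightarrow> q s \<le> q t"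
  shows "q c \<le> q d"
proof -
  obtain n :: nat where n: "0 < n" "(d - c) / real n < \<delta>"
    using ex_uniform_step_less[OF \<open>0 < \<delta>\<close>] .
  define h where "h = (d - c) / real n"
  have h: "0 \<le> h" "h < \<delta>" "real n * h = d - c"
    using n \<open>c \<le> d\<close> by (auto simp: h_def)
  have "q c \<le> q (c + real i * h)" if "i \<le> n" for i
    using that
  proof (induction i)
    case (Suc i)
    have "real (Suc i) * h \<le> real n * h"
      using Suc.prems h by (intro mult_right_mono) auto
    then have "q (c + real i * h) \<le> q (c + real (Suc i) * h)"
      using h by (intro loc) (auto simp: algebra_simps)
    with Suc show ?case by simp
  qed simp
  from this[of n] show ?thesis by (simp add: h)
qed

text \<open>On a short interval the increment of \<open>J - K * f\<close> is nearly
  \<open>(u s - K) * (f t - f s)\<close>, and the Lipschitz bound on \<open>f\<close> applies. The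
  error is proportional to \<open>\<omega>\<close> times the length, so it stays so after chaining
  and disappears as \<open>\<omega>\<close> tends to 0.\<close>

lemma stieltjes_primitive_bound:
  assumes J: "stieltjes_primitive C a b u f J" and f: "L-lipschitz_on {a..b} f"
    and u: "continuous_on {a..b} u" and "0 \<le> C" "a \<le> c" "c \<le> d" "d \<le> b"
  shows "\<bar>J d - J c - K * (f d - f c)\<bar> \<le> L * integral {c..d} (\<lambda>s. \<bar>u s - K\<bar>)"
proof -
  have "0 \<le> L" using f by (rule lipschitz_on_nonneg)
  define E where "E t = integral {a..t} (\<lambda>s. \<bar>u s - K\<bar>)" for t
  have cont: "continuous_on {s..t} (\<lambda>s. \<bar>u s - K\<bar>)" if "a \<le> s" "t \<le> b" for s t
    using that by (intro continuous_intros continuous_on_subset[OF u]) auto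
  have E_diff: "E t - E s = integral {s..t} (\<lambda>s. \<bar>u s - K\<bar>)" if "a \<le> s" "s \<le> t" "t \<le> b" for s t
  proof -
    have "E s + integral {s..t} (\<lambda>s. \<bar>u s - K\<bar>) = E t"
      unfolding E_def using that
      by (intro Henstock_Kurzweil_Integration.integral_combine integrable_continuous_real cont) auto
    then show ?thesis by simp
  qed
  define D where "D t = J t - K * f t" for t
  \<comment> \<open>In the error, \<open>C\<close> comes from one Riemann-Stieltjes term of
    \<open>J\<close>, and \<open>L\<close> from replacing the integral of
    \<open>\<bar>u s - K\<bar>\<close> by its value at the left end times the length.\<close>
  have local: "\<exists>\<delta>>0. \<forall>s t. c \<le> s \<longrightarrow> s \<le> t \<longrightarrow> t \<le> d \<longrightarrow> t - s < \<delta> \<longrightarrow>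
      \<bar>D t - D s\<bar> \<le> L * (E t - E s) + (C + L) * \<omega> * (t - s)" if "0 < \<omega>" for \<omega>
  proof -
    obtain \<delta> where "0 < \<delta>" and \<delta>:
      "\<And>s t. s \<in> {a..b} \<Longrightarrow> t \<in> {a..b} \<Longrightarrow> \<bar>s - t\<bar> < \<delta> \<Longrightarrow> \<bar>u s - u t\<bar> \<le> \<omega>"
      using continuous_on_interval_oscillation[OF u \<open>0 < \<omega>\<close>] by metis
    have "\<bar>D t - D s\<bar> \<le> L * (E t - E s) + (C + L) * \<omega> * (t - s)"
      if st: "c \<le> s" "s \<le> t" "t \<le> d" "t - s < \<delta>" for s t
    proof -
      have ab: "a \<le> s" "t \<le> b" using st assms by auto
      have osc: "\<bar>u z - u s\<bar> \<le> \<omega>" if "z \<in> {s..t}" for z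
        using that st ab by (intro \<delta>) auto
      have 1: "\<bar>J t - J s - u s * (f t - f s)\<bar> \<le> C * \<omega> * (t - s)"
        using st ab osc by (intro stieltjes_primitiveD[OF J]) auto
      have "\<bar>f t - f s\<bar> \<le> L * (t - s)"
        using lipschitz_onD[OF f, of t s] st ab by (auto simp: dist_real_def)
      then have 2: "\<bar>(u s - K) * (f t - f s)\<bar> \<le> \<bar>u s - K\<bar> * (L * (t - s))"
        unfolding abs_mult by (intro mult_left_mono) auto
      have "\<bar>integral {s..t} (\<lambda>s. \<bar>u s - K\<bar>) - \<bar>u s - K\<bar> * (t - s)\<bar> \<le> \<omega> * (t - s)"
        using st ab osc
        by (intro integral_const_approx integrable_continuous_real cont) fastforce+
      then have "\<bar>u s - K\<bar> * (t - s) \<le> (E t - E s) + \<omega> * (t - s)"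
        using E_diff[of s t] st ab by linarith
      then have 3: "L * (\<bar>u s - K\<bar> * (t - s)) \<le> L * ((E t - E s) + \<omega> * (t - s))"
        using \<open>0 \<le> L\<close> by (rule mult_left_mono)
      have "D t - D s = (J t - J s - u s * (f t - f s)) + (u s - K) * (f t - f s)"
        by (simp add: D_def algebra_simps)
      then have "\<bar>D t - D s\<bar> \<le> C * \<omega> * (t - s) + \<bar>u s - K\<bar> * (L * (t - s))"
        using 1 2 by linarith
      also have "\<bar>u s - K\<bar> * (L * (t - s)) = L * (\<bar>u s - K\<bar> * (t - s))" by simp
      also note 3
      finally show ?thesis by (simp add: algebra_simps)
    qed
    then show ?thesis using \<open>0 < \<delta>\<close> by blast
  qed
  have glob: "\<bar>D d - D c\<bar> \<le> L * (E d - E c) + (C + L) * \<omega> * (d - c)" if \<omega>: "0 < \<omega>" for \<omega>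
  proof -
    from local[OF \<omega>] obtain \<delta> where "0 < \<delta>" and \<delta>:
      "\<And>s t. c \<le> s \<Longrightarrow> s \<le> t \<Longrightarrow> t \<le> d \<Longrightarrow> t - s < \<delta> \<Longrightarrow>
        \<bar>D t - D s\<bar> \<le> L * (E t - E s) + (C + L) * \<omega> * (t - s)" by blast
    \<comment> \<open>A majorant for the increments of \<open>D\<close>: the two-sided bound says
      exactly that \<open>q - D\<close> and \<open>q + D\<close> are nondecreasing over short
      steps.\<close>
    define q where "q t = L * E t + (C + L) * \<omega> * t" for t
    have q: "q t - q s = L * (E t - E s) + (C + L) * \<omega> * (t - s)" for s t
      by (simp add: q_def algebra_simps)
    have loc: "\<bar>D t - D s\<bar> \<le> q t - q s" if "c \<le> s" "s \<le> t" "t \<le> d" "t - s < \<delta>" for s t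
      using \<delta>[OF that] unfolding q .
    have "q c - D c \<le> q d - D d"
      using \<open>0 < \<delta>\<close> \<open>c \<le> d\<close>
    proof (rule le_if_uniformly_locally_mono)
      show "q s - D s \<le> q t - D t" if "c \<le> s" "s \<le> t" "t \<le> d" "t - s < \<delta>" for s t
        using loc[OF that] by linarith
    qed
    moreover have "q c + D c \<le> q d + D d"
      using \<open>0 < \<delta>\<close> \<open>c \<le> d\<close>
    proof (rule le_if_uniformly_locally_mono)
      show "q s + D s \<le> q t + D t" if "c \<le> s" "s \<le> t" "t \<le> d" "t - s < \<delta>" for s t
        using loc[OF that] by linarith
    qed
    ultimately show ?thesis unfolding q[symmetric] by linarith
  qed
  have "\<bar>D d - D c\<bar> \<le> L * (E d - E c)"
  proof (rule field_le_epsilon)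
    fix \<epsilon> :: real assume "0 < \<epsilon>"
    \<comment> \<open>Adding 1 keeps \<open>k\<close> positive, so that
      \<open>\<epsilon> / k\<close> is admissible as oscillation also when
      \<open>c = d\<close>.\<close>
    define k where "k = (C + L) * (d - c) + 1"
    have "0 \<le> (C + L) * (d - c)" using assms \<open>0 \<le> L\<close> by simp
    then have "0 < k" "(C + L) * (d - c) \<le> k" by (auto simp: k_def)
    have "(C + L) * (\<epsilon> / k) * (d - c) = (C + L) * (d - c) * (\<epsilon> / k)" by simp
    also have "\<dots> \<le> k * (\<epsilon> / k)"
      using \<open>(C + L) * (d - c) \<le> k\<close> \<open>0 < \<epsilon>\<close> \<open>0 < k\<close> by (intro mult_right_mono) auto
    also have "\<dots> = \<epsilon>" using \<open>0 < k\<close> by simp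
    finally show "\<bar>D d - D c\<bar> \<le> L * (E d - E c) + \<epsilon>"
      using glob[of "\<epsilon> / k"] \<open>0 < \<epsilon>\<close> \<open>0 < k\<close> by simp
  qed
  moreover have "D d - D c = J d - J c - K * (f d - f c)"
    by (simp add: D_def algebra_simps)
  ultimately show ?thesis using E_diff[of c d] assms by simp
qed

section \<open>The Riemann--Stieltjes integral\<close>

lemma tagged_partition_mono:
  assumes "tagged_partition a b n X \<xi>" "i \<le> j" "j \<le> n"
  shows "X i \<le> X j"
  using assms(2,3)
proof (induction j rule: dec_induct)
  case (step j)
  then have "X j < X (Suc j)" using assms(1) by (auto simp: tagged_partition_def)
  with step show ?case by simp
qed simp

text \<open>Each Riemann-Stieltjes term is the increment of \<open>f * u - J\<close> over its cell,
  up to an error of at most \<open>C * \<omega>\<close> times the cell length. The increments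
  telescope, and the errors add up to at most \<open>C * \<omega> * (b - a)\<close>.\<close>

lemma has_RS_integral_by_parts:
  assumes J: "stieltjes_primitive C a b u f J" and u: "continuous_on {a..b} u"
    and "0 \<le> C" "a \<le> b"
  shows "has_RS_integral f u a b (f b * u b - f a * u a - (J b - J a))"
  unfolding has_RS_integral_def
proof (intro allI impI)
  fix \<epsilon> :: real assume "0 < \<epsilon>"
  \<comment> \<open>With the added 1 the total error is \<open>(k - 1) * \<omega>\<close>, strictly
    below \<open>k * \<omega> = \<epsilon>\<close>.\<close>
  define k where "k = C * (b - a) + 1"
  have "0 < k" using assms by (simp add: k_def add_nonneg_pos)
  define \<omega> where "\<omega> = \<epsilon> / k"
  have "0 < \<omega>" using \<open>0 < \<epsilon>\<close> \<open>0 < k\<close> by (simp add: \<omega>_def)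
  have small: "C * \<omega> * (b - a) < \<epsilon>"
  proof -
    have "C * \<omega> * (b - a) = (k - 1) * \<omega>" by (simp add: k_def)
    also have "\<dots> < k * \<omega>" using \<open>0 < \<omega>\<close> by simp
    also have "\<dots> = \<epsilon>" using \<open>0 < k\<close> by (simp add: \<omega>_def)
    finally show ?thesis .
  qed
  obtain \<delta> where "0 < \<delta>" and \<delta>:
    "\<And>s t. s \<in> {a..b} \<Longrightarrow> t \<in> {a..b} \<Longrightarrow> \<bar>s - t\<bar> < \<delta> \<Longrightarrow> \<bar>u s - u t\<bar> \<le> \<omega>"
    using continuous_on_interval_oscillation[OF u \<open>0 < \<omega>\<close>] by metis
  have "\<bar>(\<Sum>i<n. f (\<xi> i) * (u (X (Suc i)) - u (X i))) - (f b * u b - f a * u a - (J b - J a))\<bar> < \<epsilon>"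
    if tp: "tagged_partition a b n X \<xi>" and mesh: "\<forall>i<n. X (Suc i) - X i < \<delta>" for n X \<xi>
  proof -
    \<comment> \<open>Up to a constant, the expected indefinite integral of \<open>f\<close> against
      \<open>u\<close>.\<close>
    define \<Phi> where "\<Phi> t = f t * u t - J t" for t
    have ends: "X 0 = a" "X n = b" using tp by (auto simp: tagged_partition_def)
    have tele: "(\<Sum>i<n. \<Phi> (X (Suc i)) - \<Phi> (X i)) = \<Phi> b - \<Phi> a"
      using sum_lessThan_telescope[of "\<lambda>i. \<Phi> (X i)" n] by (simp add: ends)
    have lens: "(\<Sum>i<n. C * \<omega> * (X (Suc i) - X i)) = C * \<omega> * (b - a)"
      unfolding sum_distrib_left[symmetric]
      using sum_lessThan_telescope[of X n] by (simp add: ends)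
    \<comment> \<open>Splitting the cell at its tag avoids an Abel summation over the whole partition.\<close>
    have cell: "\<bar>f (\<xi> i) * (u (X (Suc i)) - u (X i)) - (\<Phi> (X (Suc i)) - \<Phi> (X i))\<bar>
        \<le> C * \<omega> * (X (Suc i) - X i)" if "i < n" for i
    proof -
      have order: "X i \<le> \<xi> i" "\<xi> i \<le> X (Suc i)" "X (Suc i) - X i < \<delta>"
        using tp mesh that by (auto simp: tagged_partition_def)
      have range: "a \<le> X i" "X (Suc i) \<le> b"
        using tagged_partition_mono[OF tp, of 0 i] tagged_partition_mono[OF tp, of "Suc i" n]
          that ends by auto
      \<comment> \<open>On either side of the tag \<open>u\<close> is frozen at the outer end of the
        cell, so the two terms with \<open>f (\<xi> i)\<close> combine to the Riemann-Stieltjes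
        term.\<close>
      have 1: "\<bar>J (\<xi> i) - J (X i) - u (X i) * (f (\<xi> i) - f (X i))\<bar> \<le> C * \<omega> * (\<xi> i - X i)"
        using order range by (intro stieltjes_primitiveD[OF J]) (auto intro!: \<delta>)
      have 2: "\<bar>J (X (Suc i)) - J (\<xi> i) - u (X (Suc i)) * (f (X (Suc i)) - f (\<xi> i))\<bar>
          \<le> C * \<omega> * (X (Suc i) - \<xi> i)"
        using order range by (intro stieltjes_primitiveD[OF J]) (auto intro!: \<delta>)
      have "f (\<xi> i) * (u (X (Suc i)) - u (X i)) - (\<Phi> (X (Suc i)) - \<Phi> (X i)) =
          (J (\<xi> i) - J (X i) - u (X i) * (f (\<xi> i) - f (X i))) +
          (J (X (Suc i)) - J (\<xi> i) - u (X (Suc i)) * (f (X (Suc i)) - f (\<xi> i)))"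
        by (simp add: \<Phi>_def algebra_simps)
      also have "\<bar>\<dots>\<bar> \<le> C * \<omega> * (\<xi> i - X i) + C * \<omega> * (X (Suc i) - \<xi> i)"
        using 1 2 by linarith
      finally show ?thesis by (simp add: algebra_simps)
    qed
    have "\<bar>(\<Sum>i<n. f (\<xi> i) * (u (X (Suc i)) - u (X i))) - (\<Phi> b - \<Phi> a)\<bar> =
        \<bar>\<Sum>i<n. f (\<xi> i) * (u (X (Suc i)) - u (X i)) - (\<Phi> (X (Suc i)) - \<Phi> (X i))\<bar>"
      unfolding tele[symmetric] by (simp add: sum_subtractf)
    also have "\<dots> \<le> (\<Sum>i<n. C * \<omega> * (X (Suc i) - X i))"
      using cell by (intro order_trans[OF sum_abs] sum_mono) auto
    also have "\<dots> < \<epsilon>" using lens small by simp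
    finally show ?thesis by (simp add: \<Phi>_def algebra_simps)
  qed
  then show "\<exists>\<delta>>0. \<forall>n x \<xi>. tagged_partition a b n x \<xi> \<and> (\<forall>i<n. x (Suc i) - x i < \<delta>) \<longrightarrow>
      \<bar>(\<Sum>i<n. f (\<xi> i) * (u (x (Suc i)) - u (x i))) - (f b * u b - f a * u a - (J b - J a))\<bar> < \<epsilon>"
    using \<open>0 < \<delta>\<close> by blast
qed

text \<open>Guarantees that the condition in \<open>has_RS_integral\<close> is not vacuous, which
  uniqueness of the integral rests on. The witness is a uniform grid tagged at left end
  points.\<close>

lemma ex_tagged_partition_mesh_less:
  assumes "a < b" "0 < \<delta>"
  obtains n X \<xi> where "tagged_partition a b n X \<xi>" "\<forall>i<n. X (Suc i) - X i < \<delta>"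
proof -
  obtain n :: nat where n: "0 < n" "(b - a) / real n < \<delta>"
    using ex_uniform_step_less[OF \<open>0 < \<delta>\<close>] .
  define h where "h = (b - a) / real n"
  have h: "0 < h" "h < \<delta>" "real n * h = b - a"
    using n \<open>a < b\<close> by (auto simp: h_def)
  define X where "X i = a + real i * h" for i
  have "tagged_partition a b n X X"
    using h by (auto simp: tagged_partition_def X_def algebra_simps)
  moreover have "\<forall>i<n. X (Suc i) - X i < \<delta>"
    using h by (simp add: X_def algebra_simps)
  ultimately show ?thesis by (rule that)
qed

text \<open>A partition fine enough for both candidates has one sum that would lie within less than
  half their distance of each.\<close>

lemma has_RS_integral_unique:
  assumes "has_RS_integral f u a b I" "has_RS_integral f u a b I'" "a < b"
  shows "I = I'"
proof (rule ccontr)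
  assume "I \<noteq> I'"
  define \<epsilon> where "\<epsilon> = \<bar>I - I'\<bar> / 2"
  have "0 < \<epsilon>" using \<open>I \<noteq> I'\<close> by (simp add: \<epsilon>_def)
  obtain \<delta> where "0 < \<delta>" and \<delta>:
    "\<And>n X \<xi>. tagged_partition a b n X \<xi> \<Longrightarrow> \<forall>i<n. X (Suc i) - X i < \<delta> \<Longrightarrow>
      \<bar>(\<Sum>i<n. f (\<xi> i) * (u (X (Suc i)) - u (X i))) - I\<bar> < \<epsilon>"
    using assms(1) \<open>0 < \<epsilon>\<close> unfolding has_RS_integral_def by metis
  obtain \<delta>' where "0 < \<delta>'" and \<delta>':
    "\<And>n X \<xi>. tagged_partition a b n X \<xi> \<Longrightarrow> \<forall>i<n. X (Suc i) - X i < \<delta>' \<Longrightarrow>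
      \<bar>(\<Sum>i<n. f (\<xi> i) * (u (X (Suc i)) - u (X i))) - I'\<bar> < \<epsilon>"
    using assms(2) \<open>0 < \<epsilon>\<close> unfolding has_RS_integral_def by metis
  obtain n X \<xi> where tp: "tagged_partition a b n X \<xi>"
    and "\<forall>i<n. X (Suc i) - X i < min \<delta> \<delta>'"
    using ex_tagged_partition_mesh_less[OF \<open>a < b\<close>, of "min \<delta> \<delta>'"] \<open>0 < \<delta>\<close> \<open>0 < \<delta>'\<close> by auto
  moreover define S where "S = (\<Sum>i<n. f (\<xi> i) * (u (X (Suc i)) - u (X i)))"
  ultimately have "\<bar>S - I\<bar> < \<epsilon>" "\<bar>S - I'\<bar> < \<epsilon>"
    by (auto intro!: \<delta> \<delta>')
  moreover have "\<bar>I - I'\<bar> = 2 * \<epsilon>" by (simp add: \<epsilon>_def)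
  ultimately show False by linarith
qed

lemma RS_integral_eqI:
  assumes "has_RS_integral f u a b I" "a < b"
  shows "RS_integral a b f u = I"
  unfolding RS_integral_def using assms has_RS_integral_unique by blast

section \<open>Hoelder continuous integrators and the remainder estimate\<close>

lemma Hoelder_on_imp_continuous_on:
  assumes "Hoelder_on r H S u" "0 < r"
  shows "continuous_on S u"
  unfolding continuous_on_def
proof
  fix t assume "t \<in> S"
  have "isCont (\<lambda>s. \<bar>s - t\<bar> powr r) t"
    using continuous_on_abs_diff_powr[OF \<open>0 < r\<close>, of UNIV t]
    by (simp add: continuous_on_eq_continuous_at)
  then have "isCont (\<lambda>s. H * \<bar>s - t\<bar> powr r) t"
    by (rule continuous_mult_left)
  then have "((\<lambda>s. H * \<bar>s - t\<bar> powr r) \<longlongrightarrow> 0) (at t within S)"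
    by (auto simp: isCont_def intro: tendsto_within_subset)
  moreover have "\<forall>\<^sub>F s in at t within S. norm (u s - u t) \<le> H * \<bar>s - t\<bar> powr r"
    using assms(1) \<open>t \<in> S\<close> by (auto simp: Hoelder_on_def eventually_at_filter)
  ultimately have "((\<lambda>s. u s - u t) \<longlongrightarrow> 0) (at t within S)"
    by (rule Lim_null_comparison[rotated])
  then show "(u \<longlongrightarrow> u t) (at t within S)"
    by (rule LIM_zero_cancel)
qed

theorem theorem5:
  fixes a b p r L H t0 x t1 :: real and f u :: "real \<Rightarrow> real"
  assumes "a < b" and "1 < p" and "0 < r" and "r \<le> 1"
    and "in_Lp_on p {a..b} u"
    and "0 < L" and "L-lipschitz_on {a..b} f"
    and "0 < H" and "Hoelder_on r H {a..b} u"
    and "a \<le> t0" and "t0 \<le> t1" and "t1 \<le> b" and "a \<le> x" and "x \<le> b"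
  shows "\<bar>remainder a b f u t0 x t1\<bar> \<le>
    L * H * ((t0 - a) powr (r + 1) / (r * p + 1) powr (1 / p)
           + (t1 - t0) powr (1 - 1 / p) * A_const r p t0 x t1 powr (1 / p)
           + (b - t1) powr (r + 1) / (r * p + 1) powr (1 / p))"
proof -
  have u: "continuous_on {a..b} u"
    using \<open>Hoelder_on r H {a..b} u\<close> \<open>0 < r\<close> by (rule Hoelder_on_imp_continuous_on)
  obtain J where J: "stieltjes_primitive (5 * L) a b u f J"
    using stieltjes_primitive_exists[OF \<open>L-lipschitz_on {a..b} f\<close> u \<open>0 < L\<close>] by blast
  have RS: "RS_integral a b f u = f b * u b - f a * u a - (J b - J a)"
    using assms by (intro RS_integral_eqI has_RS_integral_by_parts[OF J u]) auto
  \<comment> \<open>The reference point \<open>y\<close> may lie outside \<open>{c..d}\<close>; the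
    middle interval needs this, as \<open>x\<close> ranges over all of
    \<open>{a..b}\<close>.\<close>
  have piece: "\<bar>J d - J c - u y * (f d - f c)\<bar> \<le>
      L * H * ((d - c) powr (1 - 1 / p) * A_const r p c y d powr (1 / p))"
    if "a \<le> c" "c \<le> d" "d \<le> b" "y \<in> {a..b}" for c d y
  proof -
    have "integral {c..d} (\<lambda>s. \<bar>u s - u y\<bar>) \<le> integral {c..d} (\<lambda>s. H * \<bar>s - y\<bar> powr r)"
      using \<open>Hoelder_on r H {a..b} u\<close> \<open>0 < r\<close> that
      by (intro integral_le integrable_continuous_real continuous_intros
          continuous_on_abs_diff_powr continuous_on_subset[OF u]) (auto simp: Hoelder_on_def)
    also have "\<dots> = H * integral {c..d} (\<lambda>s. \<bar>s - y\<bar> powr r)" by simp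
    also have "\<dots> \<le> H * ((d - c) powr (1 - 1 / p) * A_const r p c y d powr (1 / p))"
      using assms that by (intro mult_left_mono integral_abs_diff_powr_le) auto
    finally have "L * integral {c..d} (\<lambda>s. \<bar>u s - u y\<bar>) \<le>
        L * (H * ((d - c) powr (1 - 1 / p) * A_const r p c y d powr (1 / p)))"
      using \<open>0 < L\<close> by simp
    moreover have "\<bar>J d - J c - u y * (f d - f c)\<bar> \<le> L * integral {c..d} (\<lambda>s. \<bar>u s - u y\<bar>)"
      using assms that by (intro stieltjes_primitive_bound[OF J _ u]) auto
    ultimately show ?thesis by (simp add: mult.assoc)
  qed
  have left: "\<bar>J t0 - J a - u a * (f t0 - f a)\<bar> \<le>
      L * H * ((t0 - a) powr (r + 1) / (r * p + 1) powr (1 / p))"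
  proof -
    have "A_const r p a a t0 = (t0 - a) powr (r * p + 1) / (r * p + 1)"
      by (simp add: A_const_def)
    then show ?thesis
      using piece[of a t0 a] powr_mean_collapse[of r p "t0 - a"] assms by simp
  qed
  have right: "\<bar>J b - J t1 - u b * (f b - f t1)\<bar> \<le>
      L * H * ((b - t1) powr (r + 1) / (r * p + 1) powr (1 / p))"
  proof -
    \<comment> \<open>The term at the reference point is \<open>0 powr (r * p + 1) = 0\<close>; for
      \<open>t1 = b\<close> both sides vanish.\<close>
    have "A_const r p t1 b b = (b - t1) powr (r * p + 1) / (r * p + 1)"
      using \<open>t1 \<le> b\<close> by (simp add: A_const_def)
    then show ?thesis
      using piece[of t1 b b] powr_mean_collapse[of r p "b - t1"] assms by simp
  qed
  \<comment> \<open>Freezing \<open>u\<close> at \<open>u a\<close>, \<open>u x\<close> and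
    \<open>u b\<close> on the three intervals makes the boundary terms at \<open>t0\<close> and
    \<open>t1\<close> exactly those subtracted in the remainder; those at \<open>a\<close> and
    \<open>b\<close> come from integration by parts.\<close>
  have "remainder a b f u t0 x t1 =
      - (J t0 - J a - u a * (f t0 - f a)) - (J t1 - J t0 - u x * (f t1 - f t0))
        - (J b - J t1 - u b * (f b - f t1))"
    unfolding remainder_def RS by (simp add: algebra_simps)
  moreover have "\<bar>J t1 - J t0 - u x * (f t1 - f t0)\<bar> \<le>
      L * H * ((t1 - t0) powr (1 - 1 / p) * A_const r p t0 x t1 powr (1 / p))"
    using assms by (intro piece) auto
  ultimately show ?thesis
    unfolding distrib_left using left right by linarith
qed

end
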